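(* Let $\Omega$ be an arbitrary non-empty set, $\vec{\Omega}\colon\mathbb{N}\to\Omega$ a sequence and $X\in L^\infty$. The sequence of averages $\overrightarrow{\Sigma X}$ has the set of cluster points $$\operatorname{CP}\left(\overrightarrow{\Sigma X}\right)=\left\{E(X)\colon E\in\operatorname{CP}(\vec{E})\right\}=\left\{E_P(X)\colon P\in\mathcal{P}\right\},$$ and therefore $$\overline{R}(X)=\sup\operatorname{CP}\left(\overrightarrow{\Sigma X}\right)=\limsup_{n\to\infty}\overrightarrow{\Sigma X}(n).$$
   Context: $L^\infty$ is the Banach space of bounded functions $X\colon\Omega\to\mathbb{R}$ with the supremum norm; $(L^\infty)^*$ is its topological dual with the weak* topology; $\chi_A$ is the indicator function of $A\subseteq\Omega$. $\operatorname{PF}(\Omega)=\{E\in(L^\infty)^*\colon E(X)\ge0\text{ whenever }X\ge0,\ E(\chi_\Omega)=1\}$ is the set of linear previsions, with the subspace topology of the weak* topology. For $X\in L^\infty$ the sequence of averages is $\overrightarrow{\Sigma X}\colon\mathbb{N}\to\mathbb{R}$, $\overrightarrow{\Sigma X}(n)=\frac1n\sum_{i=1}^nX(\vec{\Omega}(i))$. The sequence of empirical linear previsions $\vec{E}\colon\mathbb{N}\to\operatorname{PF}(\Omega)$ is $\vec{E}(n)=\big(X\mapsto\overrightarrow{\Sigma X}(n)\big)$. For a sequence $\vec S$ in a topological space, $\operatorname{CP}(\vec S)$ is its set of cluster points: $z\in\operatorname{CP}(\vec S)$ iff for every neighbourhood $N$ of $z$ and every $n_0\in\mathbb{N}$ there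 is $n\ge n_0$ with $\vec S(n)\in N$. $\mathcal{P}=\{A\mapsto E(\chi_A)\colon E\in\operatorname{CP}(\vec{E})\}$ is a set of finitely additive probabilities on $2^\Omega$. For a finitely additive probability $P$ on $2^\Omega$, $E_P$ is the unique element of $\operatorname{PF}(\Omega)$ with $E_P(\chi_A)=P(A)$ for all $A\subseteq\Omega$. Finally, $\overline{R}(X)=\sup\{E(X)\colon E\in\operatorname{CP}(\vec{E})\}$. *)

theory Defs
  imports "HOL-Analysis.Analysis" "HOL-Probability.Discrete_Topology"
begin

text \<open>
  The set \<open>\<Omega>\<close> is the type \<^typ>\<open>'a\<close>. Every function on a discrete space is continuous, so the bounded
  continuous functions on \<^typ>\<open>'a discrete\<close>, with their library norm (the supremum norm), are the
  Banach space of all bounded functions on \<open>\<Omega>\<close>.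
\<close>

type_synonym 'a linf = "'a discrete \<Rightarrow>\<^sub>C real"

definition at_pt :: "'a linf \<Rightarrow> 'a \<Rightarrow> real" where
  "at_pt X w = apply_bcontfun X (discrete w)"

definition mk_linf :: "('a \<Rightarrow> real) \<Rightarrow> 'a linf" where
  "mk_linf f = Bcontfun (\<lambda>w. f (of_discrete w))"

lemma at_pt_mk_linf:
  assumes "bounded (range f)"
  shows "at_pt (mk_linf f) w = f w"
proof -
  have "continuous_on UNIV (\<lambda>w. f (of_discrete w))"
    by (auto simp: continuous_on_open_vimage open_discrete)
  moreover have "bounded (range (\<lambda>w. f (of_discrete w)))"
    using assms by (rule bounded_subset) auto
  ultimately have "(\<lambda>w. f (of_discrete w)) \<in> bcontfun"
    by (simp add: bcontfun_def)
  then show ?thesis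
    by (simp add: at_pt_def mk_linf_def Bcontfun_inverse discrete_inverse)
qed

lemma mk_linf_at_pt: "mk_linf (at_pt X) = X"
  by (simp add: mk_linf_def at_pt_def of_discrete_inverse apply_bcontfun_inverse)

lemma bounded_range_at_pt: "bounded (range (at_pt X))"
  unfolding at_pt_def by (rule bounded_subset[OF bounded_apply_bcontfun[of X]]) auto

lemma norm_linf: "norm X = (SUP w. \<bar>at_pt X w\<bar>)"
proof -
  have "range (\<lambda>x. dist (apply_bcontfun X x) 0) = range (\<lambda>w. \<bar>at_pt X w\<bar>)"
    unfolding at_pt_def
    by (auto simp: image_iff) (metis of_discrete_inverse)+
  then show ?thesis
    by (simp add: norm_bcontfun_def dist_bcontfun_def zero_bcontfun.rep_eq)
qed

definition chi :: "'a set \<Rightarrow> 'a linf" where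
  "chi A = mk_linf (indicator A)"

lemma at_pt_chi: "at_pt (chi A) w = indicator A w"
proof -
  have "bounded (range (indicator A :: 'a \<Rightarrow> real))"
    by (rule boundedI[where B = 1]) (auto simp: indicator_def)
  then show ?thesis
    unfolding chi_def by (rule at_pt_mk_linf)
qed

text \<open>
  The topological dual is the library's space of bounded linear maps into the reals. For scalar-valued
  maps the strong operator topology is the topology of pointwise convergence, i.e. the weak* topology.
\<close>

abbreviation weak_star_topology :: "('a linf \<Rightarrow>\<^sub>L real) topology" where
  "weak_star_topology \<equiv> strong_operator_topology"

definition PF :: "('a linf \<Rightarrow>\<^sub>L real) set" where
  "PF = {E. (\<forall>X. (\<forall>w. 0 \<le> at_pt X w) \<longrightarrow> 0 \<le> blinfun_apply E X)
            \<and> blinfun_apply E (chi UNIV) = 1}"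

definition PF_topology :: "('a linf \<Rightarrow>\<^sub>L real) topology" where
  "PF_topology = subtopology weak_star_topology PF"

text \<open>
  Sequences are indexed by the positive integers: the value at \<open>0\<close> of a function on \<^typ>\<open>nat\<close>
  representing a sequence is irrelevant, which is why only \<open>n0 \<ge> 1\<close> is considered below.
\<close>

definition cluster_points :: "'b topology \<Rightarrow> (nat \<Rightarrow> 'b) \<Rightarrow> 'b set" where
  "cluster_points T S = {z \<in> topspace T.
     \<forall>N \<subseteq> topspace T. (\<exists>U. openin T U \<and> z \<in> U \<and> U \<subseteq> N) \<longrightarrow> (\<forall>n0\<ge>1. \<exists>n\<ge>n0. S n \<in> N)}"

definition averages :: "(nat \<Rightarrow> 'a) \<Rightarrow> 'a linf \<Rightarrow> nat \<Rightarrow> real" where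
  "averages \<omega> X n = 1 / real n * (\<Sum>i=1..n. at_pt X (\<omega> i))"

lemma bounded_linear_at_pt: "bounded_linear (\<lambda>X. at_pt X w)"
proof (rule bounded_linear_intro[where K = 1])
  show "norm (at_pt X w) \<le> norm X * 1" for X
    using norm_bounded[of X "discrete w"] by (simp add: at_pt_def)
qed (simp_all add: at_pt_def)

lift_definition empirical :: "(nat \<Rightarrow> 'a) \<Rightarrow> nat \<Rightarrow> 'a linf \<Rightarrow>\<^sub>L real"
  is "\<lambda>\<omega> n X. averages \<omega> X n"
  unfolding averages_def
  by (intro bounded_linear_const_mult bounded_linear_sum bounded_linear_at_pt)

lemma empirical_in_PF: "n \<ge> 1 \<Longrightarrow> empirical \<omega> n \<in> PF"
  by (auto simp: PF_def empirical.rep_eq averages_def at_pt_chi intro!: divide_nonneg_nonneg sum_nonneg)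

definition CP_empirical :: "(nat \<Rightarrow> 'a) \<Rightarrow> ('a linf \<Rightarrow>\<^sub>L real) set" where
  "CP_empirical \<omega> = cluster_points PF_topology (empirical \<omega>)"

definition limit_probs :: "(nat \<Rightarrow> 'a) \<Rightarrow> ('a set \<Rightarrow> real) set" where
  "limit_probs \<omega> = {(\<lambda>A. blinfun_apply E (chi A)) | E. E \<in> CP_empirical \<omega>}"

definition prevision_of :: "('a set \<Rightarrow> real) \<Rightarrow> 'a linf \<Rightarrow>\<^sub>L real" where
  "prevision_of P = (THE E. E \<in> PF \<and> (\<forall>A. blinfun_apply E (chi A) = P A))"

definition upper_R :: "(nat \<Rightarrow> 'a) \<Rightarrow> 'a linf \<Rightarrow> real" where
  "upper_R \<omega> X = Sup {blinfun_apply E X | E. E \<in> CP_empirical \<omega>}"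

end

theory Submission
  imports Defs
begin

text \<open>
  Evaluation at \<open>X\<close> is weak* continuous, so it maps cluster points of the empirical previsions to
  cluster points of the averages. Conversely, if \<open>z\<close> is a cluster point of the averages of \<open>X\<close>, there
  is a proper filter finer than \<^term>\<open>sequentially\<close> along which they tend to \<open>z\<close>. As in the
  Banach-Alaoglu theorem, compactness of the product of the intervals \<open>[-norm Y, norm Y]\<close> refines it
  to a filter along which the averages of every \<open>Y\<close> converge at once; the limit is a linear
  prevision with value \<open>z\<close> at \<open>X\<close>. A prevision is determined by its values on indicators since step
  functions are uniformly dense.
\<close>

section \<open>Cluster points and filters on the index set\<close>

lemma cluster_points_iff:
  "z \<in> cluster_points T S \<longleftrightarrow>
    z \<in> topspace T \<and> (\<forall>U. openin T U \<longrightarrow> z \<in> U \<longrightarrow> (\<exists>\<^sub>F n in sequentially. S n \<in> U))"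
proof
  assume z: "z \<in> cluster_points T S"
  have "\<exists>\<^sub>F n in sequentially. S n \<in> U" if "openin T U" "z \<in> U" for U
  proof -
    have "\<forall>n0\<ge>1. \<exists>n\<ge>n0. S n \<in> U"
      using z that openin_subset[of T U] unfolding cluster_points_def by blast
    \<comment> \<open>The bound 0, absent from the definition, is covered by
      \<open>n0 = 1\<close>.\<close>
    then show ?thesis
      unfolding frequently_sequentially by (metis le_trans nat_le_linear)
  qed
  then show "z \<in> topspace T \<and> (\<forall>U. openin T U \<longrightarrow> z \<in> U \<longrightarrow> (\<exists>\<^sub>F n in sequentially. S n \<in> U))"
    using z by (auto simp: cluster_points_def)
next
  assume "z \<in> topspace T \<and> (\<forall>U. openin T U \<longrightarrow> z \<in> U \<longrightarrow> (\<exists>\<^sub>F n in sequentially. S n \<in> U))"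
  then show "z \<in> cluster_points T S"
    unfolding cluster_points_def frequently_sequentially by blast
qed

text \<open>A non-trivial infimum is a proper filter along which \<open>S\<close> tends to
  \<open>z\<close>. It replaces convergent subsequences, which a sequence in a large product of
  intervals may lack.\<close>

lemma cluster_points_euclidean_iff:
  "z \<in> cluster_points euclidean S \<longleftrightarrow> inf sequentially (filtercomap S (nhds z)) \<noteq> bot"
proof -
  have "inf sequentially (filtercomap S (nhds z)) \<noteq> bot \<longleftrightarrow>
      (\<forall>U. open U \<longrightarrow> z \<in> U \<longrightarrow> (\<exists>\<^sub>F n in sequentially. S n \<in> U))" (is "?L \<longleftrightarrow> ?R")
  proof
    assume L: ?L
    show ?R
    proof (intro allI impI)
      fix U assume "open U" "z \<in> U"
      then have "eventually (\<lambda>n. S n \<in> U) (filtercomap S (nhds z))"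
        by (intro eventually_filtercomapI eventually_nhds_in_open)
      then show "\<exists>\<^sub>F n in sequentially. S n \<in> U"
        using L unfolding frequently_def trivial_limit_def eventually_inf by auto
    qed
  next
    assume R: ?R
    show ?L
    proof
      assume "inf sequentially (filtercomap S (nhds z)) = bot"
      then obtain P Q where PQ: "eventually P sequentially"
          "eventually Q (filtercomap S (nhds z))" "\<And>n. P n \<Longrightarrow> Q n \<Longrightarrow> False"
        unfolding trivial_limit_def eventually_inf by blast
      then obtain U where "open U" "z \<in> U" "\<And>n. S n \<in> U \<Longrightarrow> Q n"
        unfolding eventually_filtercomap eventually_nhds by blast
      with R have "\<exists>\<^sub>F n in sequentially. Q n"
        by (metis (mono_tags, lifting) frequently_elim1)
      moreover have "eventually (\<lambda>n. \<not> Q n) sequentially"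
        using PQ(1) by (rule eventually_mono) (use PQ(3) in blast)
      ultimately show False
        by (simp add: frequently_def)
    qed
  qed
  then show ?thesis
    by (simp add: cluster_points_iff)
qed

section \<open>Limits of the averages along filters\<close>

lemma abs_at_pt_le_norm: "\<bar>at_pt X w\<bar> \<le> norm X"
  using norm_bounded[of X "discrete w"] by (simp add: at_pt_def)

lemma norm_linf_le:
  assumes "\<And>w. \<bar>at_pt X w\<bar> \<le> b"
  shows "norm X \<le> b"
  unfolding norm_linf using assms by (intro cSUP_least) auto

text \<open>At \<open>n = 0\<close> the sum is empty, so the bound holds for every index.\<close>

lemma abs_averages_le: "\<bar>averages \<omega> X n\<bar> \<le> norm X"
proof (cases "n = 0")
  case False
  have "\<bar>\<Sum>i=1..n. at_pt X (\<omega> i)\<bar> \<le> (\<Sum>i=1..n. norm X)"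
    by (rule order_trans[OF sum_abs sum_mono]) (rule abs_at_pt_le_norm)
  then show ?thesis
    using False by (simp add: averages_def abs_mult field_simps)
qed (simp add: averages_def)

text \<open>By Tychonoff the image of \<open>G\<close> under \<open>f\<close> lives on a compact box
  and has a cluster point \<open>e\<close>.\<close>

lemma averages_converging_refinement:
  fixes G :: "nat filter"
  assumes "G \<noteq> bot"
  obtains H e where "H \<noteq> bot" "H \<le> G" "((\<lambda>n Y. averages \<omega> Y n) \<longlongrightarrow> e) H"
proof -
  define f where "f = (\<lambda>n Y. averages \<omega> Y n)"
  define K where "K = (\<Pi>\<^sub>E Y\<in>UNIV. cball (0::real) (norm (Y :: 'a linf)))"
  have "compactin (product_topology (\<lambda>_. euclidean) UNIV) K"
    unfolding K_def by (subst compactin_PiE) auto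
  then have "compact K"
    by (simp add: euclidean_product_topology)
  moreover have "f n \<in> K" for n
    by (auto simp: K_def f_def PiE_def abs_averages_le)
  then have "eventually (\<lambda>x. x \<in> K) (filtermap f G)"
    by (simp add: eventually_filtermap)
  moreover have "filtermap f G \<noteq> bot"
    using assms by (simp add: filtermap_bot_iff)
  ultimately obtain e where e: "inf (nhds e) (filtermap f G) \<noteq> bot"
    unfolding compact_filter by blast
  \<comment> \<open>Pulling the neighbourhoods of \<open>e\<close> back to indices forces
    \<open>f\<close> to tend to \<open>e\<close>; \<open>H\<close> is proper because a set
    separating it would also separate \<open>nhds e\<close> from the image of
    \<open>G\<close>.\<close>
  define H where "H = inf (filtercomap f (nhds e)) G"
  have "H \<noteq> bot"
  proof
    assume "H = bot"
    then obtain P Q where PQ: "eventually P (nhds e)" "eventually Q G" "\<And>n. P (f n) \<Longrightarrow> Q n \<Longrightarrow> False"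
      unfolding H_def trivial_limit_def eventually_inf eventually_filtercomap by blast
    from PQ(2) have "eventually (\<lambda>n. \<not> P (f n)) G"
      by (rule eventually_mono) (use PQ(3) in blast)
    then have "eventually (\<lambda>x. \<not> P x) (filtermap f G)"
      by (simp add: eventually_filtermap)
    with PQ(1) e show False
      unfolding trivial_limit_def eventually_inf by blast
  qed
  moreover have "H \<le> G"
    by (simp add: H_def)
  moreover have "(f \<longlongrightarrow> e) H"
    unfolding filterlim_iff_le_filtercomap H_def by simp
  ultimately show ?thesis
    using that f_def by blast
qed

text \<open>Linearity, the norm bound, positivity and normalisation of the averages all pass to the
  pointwise limit \<open>e\<close>, which is therefore a prevision.\<close>

lemma empirical_limit_exists:
  fixes G :: "nat filter"
  assumes "G \<noteq> bot" "G \<le> sequentially"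
  obtains H E where "H \<noteq> bot" "H \<le> G" "E \<in> CP_empirical \<omega>"
    "\<And>Y. ((averages \<omega> Y) \<longlongrightarrow> blinfun_apply E Y) H"
proof -
  obtain H e where H: "H \<noteq> bot" "H \<le> G" and lim: "((\<lambda>n Y. averages \<omega> Y n) \<longlongrightarrow> e) H"
    using averages_converging_refinement[OF assms(1)] .
  have Hseq: "H \<le> sequentially"
    using H assms by order
  have lim': "((averages \<omega> Y) \<longlongrightarrow> e Y) H" for Y
  proof -
    have "continuous_on UNIV (\<lambda>x. x Y :: real)"
      by (rule continuous_on_product_coordinates)
    from continuous_on_tendsto_compose[OF this lim] show ?thesis
      by simp
  qed
  have lin: "averages \<omega> (Y + Z) = (\<lambda>n. averages \<omega> Y n + averages \<omega> Z n)"
      "averages \<omega> (r *\<^sub>R Y) = (\<lambda>n. r * averages \<omega> Y n)" for Y Z r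
    by (simp_all add: fun_eq_iff averages_def at_pt_def sum.distrib sum_distrib_left algebra_simps)
  have "bounded_linear e"
  proof (rule bounded_linear_intro[where K = 1])
    show "e (Y + Z) = e Y + e Z" for Y Z
      using tendsto_unique[OF H(1) lim'[of "Y + Z"]] tendsto_add[OF lim' lim', of Y Z]
      by (simp add: lin)
    show "e (r *\<^sub>R Y) = r *\<^sub>R e Y" for r Y
      using tendsto_unique[OF H(1) lim'[of "r *\<^sub>R Y"]] tendsto_mult_left[OF lim', of r Y]
      by (simp add: lin)
    show "norm (e Y) \<le> norm Y * 1" for Y
      using tendsto_norm[OF lim'[of Y]]
      by (rule tendsto_upperbound) (auto simp: abs_averages_le H)
  qed
  then obtain E where E: "e = blinfun_apply E"
    by (metis bounded_linear_Blinfun_apply)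
  have "E \<in> PF"
  proof -
    have "0 \<le> e Y" if "\<And>w. 0 \<le> at_pt Y w" for Y
      using lim'[of Y] by (rule tendsto_lowerbound)
        (auto simp: averages_def H that intro!: always_eventually divide_nonneg_nonneg sum_nonneg)
    moreover have "e (chi UNIV) = 1"
    proof (rule tendsto_unique[OF H(1) lim'])
      \<comment> \<open>Only eventually: at \<open>n = 0\<close> the average is 0.\<close>
      have "eventually (\<lambda>n. averages \<omega> (chi UNIV) n = 1) sequentially"
        by (rule eventually_mono[OF eventually_gt_at_top[of 0]]) (simp add: averages_def at_pt_chi)
      then show "((averages \<omega> (chi UNIV)) \<longlongrightarrow> 1) H"
        by (intro tendsto_eventually) (rule filter_leD[OF Hseq])
    qed
    ultimately show ?thesis
      by (simp add: PF_def E)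
  qed
  moreover have "\<exists>\<^sub>F n in sequentially. empirical \<omega> n \<in> U"
    if U: "openin PF_topology U" "E \<in> U" for U
  proof -
    \<comment> \<open>Weak* open sets are preimages of open sets of the product topology, where
      \<open>e\<close> is the limit.\<close>
    obtain V where V: "openin strong_operator_topology V" "U = V \<inter> PF"
      using U by (auto simp: PF_topology_def openin_subtopology)
    then obtain W where W: "open W" "V = blinfun_apply -` W"
      by (auto simp: strong_operator_topology_def openin_pullback_topology)
    have "e \<in> W"
      using U V W E by auto
    then have "eventually (\<lambda>n. (\<lambda>Y. averages \<omega> Y n) \<in> W) H"
      using W lim by (simp add: topological_tendstoD)
    \<comment> \<open>\<open>empirical \<omega> 0\<close> is the zero map and lies outside
      \<open>PF\<close>.\<close>
    moreover have "eventually (\<lambda>n. n \<ge> 1) H"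
      by (rule filter_leD[OF Hseq eventually_ge_at_top])
    ultimately have "eventually (\<lambda>n. empirical \<omega> n \<in> U) H"
      by eventually_elim (simp add: V W empirical_in_PF empirical.rep_eq)
    then have "\<exists>\<^sub>F n in H. empirical \<omega> n \<in> U"
      by (rule eventually_frequently[OF H(1)])
    then show ?thesis
      using Hseq by (meson filter_leD frequently_def)
  qed
  ultimately have "E \<in> CP_empirical \<omega>"
    unfolding CP_empirical_def cluster_points_iff
    by (auto simp: PF_topology_def strong_operator_topology_topspace)
  then show ?thesis
    using that H lim' E by blast
qed

section \<open>Cluster points of the averages of a fixed function\<close>

lemma openin_PF_eval_vimage:
  assumes "open U"
  shows "openin PF_topology {E \<in> PF. blinfun_apply E X \<in> U}"
proof -
  have "openin strong_operator_topology {E. blinfun_apply E X \<in> U}"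
    using openin_continuous_map_preimage[OF strong_operator_topology_continuous_evaluation[of X], of U] assms
    by (simp add: strong_operator_topology_topspace)
  then show ?thesis
    unfolding PF_topology_def openin_subtopology by blast
qed

lemma cluster_points_averages:
  "cluster_points euclidean (averages \<omega> X) = {blinfun_apply E X | E. E \<in> CP_empirical \<omega>}"
proof (intro equalityI subsetI)
  fix z assume z: "z \<in> cluster_points euclidean (averages \<omega> X)"
  \<comment> \<open>The averages of \<open>X\<close> tend to \<open>z\<close> along
    \<open>G\<close>, hence along any refinement \<open>H\<close>; uniqueness of limits then gives
    \<open>E\<close> the value \<open>z\<close> at \<open>X\<close>.\<close>
  define G where "G = inf sequentially (filtercomap (averages \<omega> X) (nhds z))"
  have "G \<noteq> bot" "G \<le> sequentially"
    using z by (simp_all add: G_def cluster_points_euclidean_iff)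
  then obtain H E where H: "H \<noteq> bot" "H \<le> G" and E: "E \<in> CP_empirical \<omega>"
    and lim: "(averages \<omega> X \<longlongrightarrow> blinfun_apply E X) H"
    by (rule empirical_limit_exists) blast
  have "H \<le> filtercomap (averages \<omega> X) (nhds z)"
    using H(2) by (simp add: G_def)
  then have "(averages \<omega> X \<longlongrightarrow> z) H"
    by (simp add: filterlim_iff_le_filtercomap)
  then have "z = blinfun_apply E X"
    using lim H(1) by (rule tendsto_unique[rotated 1])
  then show "z \<in> {blinfun_apply E X | E. E \<in> CP_empirical \<omega>}"
    using E by blast
next
  fix z assume "z \<in> {blinfun_apply E X | E. E \<in> CP_empirical \<omega>}"
  then obtain E where E: "E \<in> CP_empirical \<omega>" "z = blinfun_apply E X"
    by blast
  then have "E \<in> PF"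
    by (auto simp: CP_empirical_def cluster_points_iff PF_topology_def)
  have "\<exists>\<^sub>F n in sequentially. averages \<omega> X n \<in> U" if "open U" "z \<in> U" for U
  proof -
    have "\<exists>\<^sub>F n in sequentially. empirical \<omega> n \<in> {E \<in> PF. blinfun_apply E X \<in> U}"
      using E \<open>E \<in> PF\<close> that openin_PF_eval_vimage[of U X]
      unfolding CP_empirical_def cluster_points_iff by blast
    then show ?thesis
      by (rule frequently_elim1) (simp add: empirical.rep_eq)
  qed
  then show "z \<in> cluster_points euclidean (averages \<omega> X)"
    by (simp add: cluster_points_iff)
qed

section \<open>Previsions are determined by indicators\<close>

text \<open>Round \<open>X\<close> down to multiples of \<epsilon>; boundedness of \<open>X\<close>
  leaves finitely many levels.\<close>

lemma step_function_approx:
  fixes X :: "'a linf"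
  assumes "\<epsilon> > 0"
  obtains S c where "finite (S :: int set)"
    "norm (X - (\<Sum>k\<in>S. c k *\<^sub>R chi {w. \<lfloor>at_pt X w / \<epsilon>\<rfloor> = k})) \<le> \<epsilon>"
proof -
  define S where "S = {\<lfloor>- (norm X / \<epsilon>)\<rfloor>..\<lfloor>norm X / \<epsilon>\<rfloor>}"
  define Y where "Y = (\<Sum>k\<in>S. (\<epsilon> * of_int k) *\<^sub>R chi {w. \<lfloor>at_pt X w / \<epsilon>\<rfloor> = k})"
  have "\<bar>at_pt (X - Y) w\<bar> \<le> \<epsilon>" for w
  proof -
    let ?k = "\<lfloor>at_pt X w / \<epsilon>\<rfloor>"
    have "- norm X \<le> at_pt X w" "at_pt X w \<le> norm X"
      using abs_at_pt_le_norm[of X w] by linarith+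
    then have "- (norm X / \<epsilon>) \<le> at_pt X w / \<epsilon>" "at_pt X w / \<epsilon> \<le> norm X / \<epsilon>"
      using assms by (simp_all add: field_simps)
    then have k: "?k \<in> S"
      unfolding S_def by (auto intro: floor_mono)
    interpret bounded_linear "\<lambda>X. at_pt X w"
      by (rule bounded_linear_at_pt)
    \<comment> \<open>The level sets are disjoint, so only the term of the level containing
      \<open>w\<close> survives.\<close>
    have "at_pt Y w = (\<Sum>k\<in>S. if ?k = k then \<epsilon> * of_int k else 0)"
      unfolding Y_def sum by (intro sum.cong) (auto simp: scaleR at_pt_chi)
    also have "\<dots> = \<epsilon> * of_int ?k"
      using k by (simp add: S_def)
    finally have Y: "at_pt Y w = \<epsilon> * of_int ?k" .
    show ?thesis
      using floor_divide_lower[OF assms, of "at_pt X w"] floor_divide_upper[OF assms, of "at_pt X w"]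
        assms
      by (simp add: diff Y abs_le_iff algebra_simps)
  qed
  then have "norm (X - Y) \<le> \<epsilon>"
    by (rule norm_linf_le)
  then show ?thesis
    using that[of S "\<lambda>k. \<epsilon> * of_int k"] by (simp add: Y_def S_def)
qed

text \<open>The difference \<open>D\<close> vanishes on step functions, so by continuity it vanishes
  everywhere. This gives the uniqueness behind \<open>prevision_of\<close>.\<close>

lemma blinfun_eq_if_eq_chi:
  fixes E F :: "'a linf \<Rightarrow>\<^sub>L real"
  assumes "\<And>A. blinfun_apply E (chi A) = blinfun_apply F (chi A)"
  shows "E = F"
proof (rule blinfun_eqI)
  fix X
  define D where "D = E - F"
  have D_chi: "blinfun_apply D (chi A) = 0" for A
    using assms by (simp add: D_def blinfun.diff_left)
  have bound: "\<bar>blinfun_apply D X\<bar> \<le> norm D * \<epsilon>" if \<epsilon>: "\<epsilon> > 0" for \<epsilon>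
  proof -
    obtain S c where
      "norm (X - (\<Sum>k\<in>S. c k *\<^sub>R chi {w. \<lfloor>at_pt X w / \<epsilon>\<rfloor> = k})) \<le> \<epsilon>" (is "norm (X - ?Y) \<le> \<epsilon>")
      using step_function_approx[OF \<epsilon>] .
    then have "norm (blinfun_apply D (X - ?Y)) \<le> norm D * \<epsilon>"
      by (meson norm_blinfun order_trans mult_left_mono norm_ge_zero)
    moreover have "blinfun_apply D ?Y = 0"
      by (simp add: blinfun.sum_right blinfun.scaleR_right D_chi)
    ultimately show ?thesis
      by (simp add: blinfun.diff_right)
  qed
  have "\<bar>blinfun_apply D X\<bar> \<le> 0 + \<epsilon>" if "\<epsilon> > 0" for \<epsilon>
  proof -
    \<comment> \<open>The added 1 keeps the divisor positive when \<open>D = 0\<close>.\<close>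
    have pos: "norm D + 1 > 0"
      by (simp add: add_nonneg_pos)
    then have "norm D * (\<epsilon> / (norm D + 1)) \<le> \<epsilon>"
      using that by (simp add: pos_divide_le_eq algebra_simps)
    with bound[OF divide_pos_pos[OF that pos]] show ?thesis
      by linarith
  qed
  then have "blinfun_apply D X = 0"
    by (metis abs_le_zero_iff field_le_epsilon)
  then show "blinfun_apply E X = blinfun_apply F X"
    by (simp add: D_def blinfun.diff_left)
qed

lemma prevision_of_eq:
  assumes "E \<in> PF"
  shows "prevision_of (\<lambda>A. blinfun_apply E (chi A)) = E"
  unfolding prevision_of_def
  by (rule the_equality) (use assms in \<open>auto intro: blinfun_eq_if_eq_chi\<close>)

section \<open>Upper limits\<close>

text \<open>The upper limit is the limit of a subsequence, hence a cluster point, and no cluster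
  point exceeds it: the supremum is a maximum.\<close>

lemma Sup_cluster_points_bounded:
  fixes a :: "nat \<Rightarrow> real"
  assumes bdd: "\<And>n. \<bar>a n\<bar> \<le> B"
  shows "ereal (Sup (cluster_points euclidean a)) = limsup (\<lambda>n. ereal (a n))"
proof -
  let ?l = "limsup (\<lambda>n. ereal (a n))"
  obtain r where r: "strict_mono r" "((\<lambda>n. ereal (a n)) \<circ> r) \<longlonglongrightarrow> ?l"
    using limsup_subseq_lim by blast
  have bd: "- B \<le> a n" "a n \<le> B" for n
    using bdd[of n] by linarith+
  \<comment> \<open>These bounds make the extended real \<open>?l\<close> finite.\<close>
  have "?l \<le> ereal B" "ereal (- B) \<le> ?l"
    by (rule LIMSEQ_le_const2[OF r(2)], use bd in simp)
       (rule LIMSEQ_le_const[OF r(2)], use bd in \<open>simp del: uminus_ereal.simps\<close>)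
  then obtain L where L: "?l = ereal L"
    by (cases ?l) auto
  have lim: "(\<lambda>n. a (r n)) \<longlonglongrightarrow> L"
    using r(2) by (simp add: L comp_def)
  have "L \<in> cluster_points euclidean a"
    unfolding cluster_points_iff
  proof (intro conjI allI impI)
    fix U assume "openin euclidean U" "L \<in> U"
    then have "eventually (\<lambda>n. a (r n) \<in> U) sequentially"
      using lim by (simp add: topological_tendstoD)
    then obtain N where N: "\<And>n. n \<ge> N \<Longrightarrow> a (r n) \<in> U"
      by (auto simp: eventually_sequentially)
    \<comment> \<open>Beyond a given \<open>m\<close>, the index \<open>r (max m N)\<close> works,
      since \<open>r k \<ge> k\<close>.\<close>
    show "\<exists>\<^sub>F n in sequentially. a n \<in> U"
      unfolding frequently_sequentially
      by (metis N max.cobounded1 max.cobounded2 order_trans r(1) seq_suble)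
  qed simp
  moreover have "z \<le> L" if z: "z \<in> cluster_points euclidean a" for z
  proof (rule ccontr)
    assume "\<not> z \<le> L"
    \<comment> \<open>Near \<open>z\<close> the sequence would exceed \<open>c\<close> infinitely
      often, yet an upper limit below \<open>c\<close> keeps it eventually below
      \<open>c\<close>.\<close>
    then obtain c where c: "L < c" "c < z"
      using dense not_le by blast
    have "\<exists>\<^sub>F n in sequentially. a n \<in> {c<..}"
      using z c unfolding cluster_points_iff by (metis greaterThan_iff open_greaterThan open_openin)
    moreover have "eventually (\<lambda>n. ereal (a n) < ereal c) sequentially"
      by (rule Limsup_lessD) (simp add: L c)
    ultimately show False
      by (auto simp: frequently_def elim!: notE eventually_mono)
  qed
  ultimately have "Sup (cluster_points euclidean a) = L"
    by (rule cSup_eq_maximum)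
  then show ?thesis
    by (simp add: L)
qed

theorem proposition2p1:
  fixes \<omega> :: "nat \<Rightarrow> 'a" and X :: "'a linf"
  shows "cluster_points euclidean (averages \<omega> X) = {blinfun_apply E X | E. E \<in> CP_empirical \<omega>}
    \<and> {blinfun_apply E X | E. E \<in> CP_empirical \<omega>}
        = {blinfun_apply (prevision_of P) X | P. P \<in> limit_probs \<omega>}
    \<and> upper_R \<omega> X = Sup (cluster_points euclidean (averages \<omega> X))
    \<and> ereal (Sup (cluster_points euclidean (averages \<omega> X)))
        = limsup (\<lambda>n. ereal (averages \<omega> X n))"
proof (intro conjI)
  have "CP_empirical \<omega> \<subseteq> PF"
    by (auto simp: CP_empirical_def cluster_points_iff PF_topology_def)
  \<comment> \<open>Passing from \<open>E\<close> to its probability and back returns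
    \<open>E\<close>, so both descriptions range over the same previsions.\<close>
  then have "prevision_of (\<lambda>A. blinfun_apply E (chi A)) = E" if "E \<in> CP_empirical \<omega>" for E
    using that by (auto intro: prevision_of_eq)
  then show "{blinfun_apply E X | E. E \<in> CP_empirical \<omega>}
      = {blinfun_apply (prevision_of P) X | P. P \<in> limit_probs \<omega>}"
    unfolding limit_probs_def by (auto; metis)
  show "upper_R \<omega> X = Sup (cluster_points euclidean (averages \<omega> X))"
    by (simp add: upper_R_def cluster_points_averages)
  show "ereal (Sup (cluster_points euclidean (averages \<omega> X)))
      = limsup (\<lambda>n. ereal (averages \<omega> X n))"
    using abs_averages_le by (rule Sup_cluster_points_bounded)
qed (rule cluster_points_averages)

end
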